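(* The maximal length of an oasis base $b$ is $2$ for $b=2$, $6$ for $b=4$, $5$ for $b=6$, $8$ for each $b\in\{8,10,12,14,16,18\}$, and $9$ for $b=20$. That is, for each of these $b$, there exists a $k$-oasis base $b$ with $k$ equal to the stated value, and no $k$-oasis base $b$ exists with $k$ larger than the stated value.
   Context: For integers $c\geq 0$ and $b\geq 2$, the augmented generalized happy function $S_{[c,b]}:\mathbb{Z}^+\to\mathbb{Z}^+$ is defined by $S_{[c,b]}\left(\sum_{i=0}^n a_i b^i\right)=c+\sum_{i=0}^n a_i^2$, where $0\le a_i\le b-1$, $a_n\neq 0$ (the base $b$ expansion). A positive integer $a$ is a fixed point of $S_{[c,b]}$ if $S_{[c,b]}(a)=a$. For $b\geq 2$ and $k\in\mathbb{Z}^+$, a $k$-oasis base $b$ is a set of $k$ consecutive non-negative integers $c$ such that for each of them $S_{[c,b]}$ has at least one fixed point; its length is $k$. *)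

theory Defs
  imports Main
begin

(* The index set picks out exactly the positions of the base b expansion of x, for b >= 2 and
   x > 0, and (x div b ^ i) mod b is the digit at position i; see happy_base_expansion below.
   The function is meant for positive x only (happy c b 0 = c is a junk value). *)
definition happy :: "nat \<Rightarrow> nat \<Rightarrow> nat \<Rightarrow> nat" where
  "happy c b x = c + (\<Sum>i | b ^ i \<le> x. ((x div b ^ i) mod b)\<^sup>2)"

lemma base_expansion_less:
  fixes b :: nat
  assumes "\<And>i. i < n \<Longrightarrow> a i < b"
  shows "(\<Sum>i<n. a i * b ^ i) < b ^ n"
  using assms
proof (induction n)
  case 0
  then show ?case by simp
next
  case (Suc n)
  have "(\<Sum>i<n. a i * b ^ i) < b ^ n" using Suc by simp
  then have "(\<Sum>i<Suc n. a i * b ^ i) < (a n + 1) * b ^ n" by simp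
  also have "\<dots> \<le> b * b ^ n" using Suc.prems[of n] by (intro mult_right_mono) auto
  finally show ?case by simp
qed

lemma base_expansion_digit:
  fixes b :: nat
  assumes "\<And>i. i \<le> n \<Longrightarrow> a i < b" "k \<le> n"
  shows "((\<Sum>i\<le>n. a i * b ^ i) div b ^ k) mod b = a k"
proof -
  have b: "b > 0" using assms(1)[of k] assms(2) by auto
  have less: "(\<Sum>i<k. a i * b ^ i) < b ^ k"
    using assms by (intro base_expansion_less) auto
  have split: "{..n} = {..<k} \<union> insert k {k<..n}" using assms(2) by auto
  have "(\<Sum>i\<le>n. a i * b ^ i)
      = (\<Sum>i<k. a i * b ^ i) + (a k * b ^ k + (\<Sum>i\<in>{k<..n}. a i * b ^ i))"
    unfolding split by (subst sum.union_disjoint) auto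
  also have "(\<Sum>i\<in>{k<..n}. a i * b ^ i) = b ^ k * (b * (\<Sum>i\<in>{k<..n}. a i * b ^ (i - Suc k)))"
    unfolding sum_distrib_left
  proof (rule sum.cong)
    fix i assume "i \<in> {k<..n}"
    then have "b ^ i = b ^ k * (b * b ^ (i - Suc k))"
      by (simp flip: power_Suc power_add)
    then show "a i * b ^ i = b ^ k * (b * (a i * b ^ (i - Suc k)))" by simp
  qed simp
  finally have "(\<Sum>i\<le>n. a i * b ^ i)
      = (\<Sum>i<k. a i * b ^ i) + b ^ k * (a k + b * (\<Sum>i\<in>{k<..n}. a i * b ^ (i - Suc k)))"
    by (simp add: algebra_simps)
  then have "(\<Sum>i\<le>n. a i * b ^ i) div b ^ k = a k + b * (\<Sum>i\<in>{k<..n}. a i * b ^ (i - Suc k))"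
    using less b by simp
  then show ?thesis using assms by simp
qed

lemma happy_base_expansion:
  assumes "b \<ge> 2" "\<And>i. i \<le> n \<Longrightarrow> a i \<le> b - 1" "a n \<noteq> 0"
  shows "happy c b (\<Sum>i\<le>n. a i * b ^ i) = c + (\<Sum>i\<le>n. (a i)\<^sup>2)"
proof -
  let ?x = "\<Sum>i\<le>n. a i * b ^ i"
  have lt: "a i < b" if "i \<le> n" for i using assms(1) assms(2)[OF that] by simp
  have "?x < b ^ Suc n"
    using base_expansion_less[of "Suc n" a b] lt by (simp add: lessThan_Suc_atMost)
  moreover have "b ^ n \<le> ?x"
  proof -
    have "b ^ n \<le> a n * b ^ n" using assms(3) by simp
    also have "\<dots> \<le> ?x" by (rule member_le_sum) auto
    finally show ?thesis .
  qed
  ultimately have "b ^ i \<le> ?x \<longleftrightarrow> i \<le> n" for i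
  proof (cases "i \<le> n")
    case True
    then have "b ^ i \<le> b ^ n" using assms(1) by (intro power_increasing) auto
    with True \<open>b ^ n \<le> ?x\<close> show ?thesis by linarith
  next
    case False
    then have "b ^ Suc n \<le> b ^ i" using assms(1) by (intro power_increasing) auto
    with False \<open>?x < b ^ Suc n\<close> show ?thesis by linarith
  qed
  then have "{i. b ^ i \<le> ?x} = {..n}" by auto
  then show ?thesis
    unfolding happy_def using base_expansion_digit[of n a b] lt by simp
qed

definition is_fixed_point :: "nat \<Rightarrow> nat \<Rightarrow> nat \<Rightarrow> bool" where
  "is_fixed_point c b a \<longleftrightarrow> a > 0 \<and> happy c b a = a"

definition is_oasis :: "nat \<Rightarrow> nat \<Rightarrow> nat set \<Rightarrow> bool" where
  "is_oasis k b C \<longleftrightarrow>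
     k > 0 \<and> (\<exists>m. C = {m..<m + k}) \<and> (\<forall>c\<in>C. \<exists>a. is_fixed_point c b a)"

definition is_max_oasis_length :: "nat \<Rightarrow> nat \<Rightarrow> bool" where
  "is_max_oasis_length b k \<longleftrightarrow>
     (\<exists>C. is_oasis k b C) \<and> (\<forall>l>k. \<not> (\<exists>C. is_oasis l b C))"

end

theory Submission
  imports Defs
begin

text \<open>
  A number \<open>c\<close> admits a fixed point iff it has the form \<open>x - s(x)\<close> with \<open>x > 0\<close>, where \<open>s\<close> is the
  sum of the squared digits. Write \<open>x = b\<^sup>3 A + r\<close> with \<open>r < b\<^sup>3\<close>, so that
  \<open>x - s(x) = (b\<^sup>3 A - s(A)) + (r - s(r))\<close>. Since \<open>s(A + 1) \<le> s(A) + 2b - 3\<close>, the first term grows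
  with \<open>A\<close> faster than the spread of the second, so values belonging to different \<open>A\<close> differ by at
  least 2. Every oasis is therefore a translate of a run of consecutive integers among the finitely
  many values \<open>r - s(r)\<close>, and these are enumerated in increasing order.
\<close>

section \<open>Recursion and growth of the sum of squared digits\<close>

definition digit_square_sum :: "nat \<Rightarrow> nat \<Rightarrow> nat" where
  "digit_square_sum b x = (\<Sum>i | b ^ i \<le> x. ((x div b ^ i) mod b)\<^sup>2)"

lemma happy_eq: "happy c b x = c + digit_square_sum b x"
  by (simp add: happy_def digit_square_sum_def)

lemma digit_square_sum_0 [simp]: "b > 0 \<Longrightarrow> digit_square_sum b 0 = 0"
  by (simp add: digit_square_sum_def)

lemma finite_power_le:
  fixes b :: nat
  assumes "b \<ge> 2"
  shows "finite {i. b ^ i \<le> x}"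
proof (rule finite_subset)
  have "i < b ^ i" for i
    by (rule less_le_trans[OF less_exp power_mono[OF assms]]) simp
  then show "{i. b ^ i \<le> x} \<subseteq> {..x}"
    by (auto intro: order.trans less_imp_le)
qed simp

lemma digit_square_sum_rec:
  assumes "b \<ge> 2"
  shows "digit_square_sum b x = (x mod b)\<^sup>2 + digit_square_sum b (x div b)"
proof (cases "x = 0")
  case True
  then show ?thesis using assms by simp
next
  case False
  have shift: "b ^ Suc i \<le> x \<longleftrightarrow> b ^ i \<le> x div b" for i
    using assms by (simp add: less_eq_div_iff_mult_less_eq mult.commute)
  have "i \<in> insert 0 (Suc ` {i. b ^ i \<le> x div b})" if "b ^ i \<le> x" for i
    using that shift by (cases i) auto
  then have "{i. b ^ i \<le> x} = insert 0 (Suc ` {i. b ^ i \<le> x div b})"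
    using False shift by auto
  \<comment> \<open>A sum over an infinite set defaults to 0, so splitting off position 0 needs
    finiteness.\<close>
  moreover have "finite {i. b ^ i \<le> x div b}"
    by (rule finite_power_le[OF assms])
  ultimately show ?thesis
    by (simp add: digit_square_sum_def sum.reindex div_mult2_eq)
qed

lemma digit_square_sum_append_digit:
  assumes "b \<ge> 2" "d < b"
  shows "digit_square_sum b (b * x + d) = d\<^sup>2 + digit_square_sum b x"
  using assms by (subst digit_square_sum_rec) auto

text \<open>Without a carry the last digit satisfies \<open>d \<le> b - 2\<close>, and its square
  grows by \<open>2 * d + 1\<close>, at most \<open>2 * b - 3\<close>. With a carry it drops from
  \<open>b - 1\<close> to 0, and the bound is inherited from the quotient \<open>q\<close>.\<close>

lemma digit_square_sum_Suc_le:
  assumes "b \<ge> 2"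
  shows "digit_square_sum b (Suc x) + 3 \<le> digit_square_sum b x + 2 * b"
proof (induction x rule: less_induct)
  case (less x)
  define q d where "q = x div b" and "d = x mod b"
  have x: "x = b * q + d" and d: "d < b"
    using assms by (auto simp: q_def d_def)
  show ?case
  proof (cases "Suc d < b")
    case True
    then have "digit_square_sum b (Suc x) = (Suc d)\<^sup>2 + digit_square_sum b q"
      using digit_square_sum_append_digit[OF assms True, of q] by (simp add: x)
    then show ?thesis
      using digit_square_sum_append_digit[OF assms d, of q] True
      by (simp add: x power2_eq_square)
  next
    case False
    then have sx: "Suc x = b * Suc q + 0" using d by (simp add: x)
    have "1 * q \<le> b * q" using assms by (intro mult_right_mono) auto
    then have "q < x" using False assms unfolding x by linarith
    have "digit_square_sum b (Suc x) = digit_square_sum b (Suc q)"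
      unfolding sx using assms by (subst digit_square_sum_append_digit) auto
    then show ?thesis
      using less[OF \<open>q < x\<close>] digit_square_sum_append_digit[OF assms d, of q]
      by (simp add: x)
  qed
qed

lemma digit_square_sum_add_le:
  assumes "b \<ge> 2"
  shows "int (digit_square_sum b (x + n)) \<le> int (digit_square_sum b x) + (2 * int b - 3) * int n"
proof (induction n)
  case (Suc n)
  then show ?case
    using digit_square_sum_Suc_le[OF assms, of "x + n"] by (simp add: algebra_simps)
qed simp

section \<open>Separation of values with different leading parts\<close>

definition excess :: "nat \<Rightarrow> nat \<Rightarrow> int" where
  "excess b x = int x - int (digit_square_sum b x)"

lemma is_fixed_point_iff: "is_fixed_point c b x \<longleftrightarrow> x > 0 \<and> excess b x = int c"
  by (auto simp: is_fixed_point_def happy_eq excess_def)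

text \<open>These are the values \<open>r - s(r)\<close> for
  \<open>r = d2 * b^2 + d1 * b + d0\<close>, grouped digit by digit; leading zeros are allowed and
  contribute nothing.\<close>

definition three_digit_excess :: "int \<Rightarrow> int set" where
  "three_digit_excess b =
     {d2 * (b * b - d2) + (d0 - d0 * d0 + d1 * (b - d1)) | d0 d1 d2.
       d0 \<in> {0..<b} \<and> d1 \<in> {0..<b} \<and> d2 \<in> {0..<b}}"

text \<open>The right-hand side is a lower bound for the growth of \<open>b^3 * A - s(A)\<close>
  when \<open>A\<close> increases by one; the 2 on the left is the gap to be left between blocks.
  Values are at most those for \<open>d2 = b - 1\<close>, \<open>d1 = b / 2\<close>,
  \<open>d0 = 0\<close>, and at least those for digits 0, 0, \<open>b - 1\<close>; these differ by
  \<open>b^3 - 3 * b^2 / 4 - b + 1\<close>.\<close>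

lemma three_digit_excess_spread:
  assumes "b \<ge> 2" "u \<in> three_digit_excess b" "v \<in> three_digit_excess b"
  shows "v - u + 2 \<le> b ^ 3 - 2 * b + 3"
proof -
  obtain d0 d1 d2 where d: "0 \<le> d0" "d0 < b" "0 \<le> d1" "d1 < b" "0 \<le> d2" "d2 < b"
    and v: "v = d2 * (b * b - d2) + (d0 - d0 * d0 + d1 * (b - d1))"
    using assms(3) by (auto simp: three_digit_excess_def)
  obtain e0 e1 e2 where e: "0 \<le> e0" "e0 < b" "0 \<le> e1" "e1 < b" "0 \<le> e2" "e2 < b"
    and u: "u = e2 * (b * b - e2) + (e0 - e0 * e0 + e1 * (b - e1))"
    using assms(2) by (auto simp: three_digit_excess_def)
  have bb: "2 * b \<le> b * b" using assms(1) by (simp add: mult_right_mono)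
  \<comment> \<open>Each product, up to a constant factor, is the distance of one digit's term from
    its extreme value.\<close>
  have "0 \<le> (b - 1 - d2) * (b * b - (b - 1) - d2)"
    using d bb by (intro mult_nonneg_nonneg; linarith)
  moreover have "d0 - d0 * d0 \<le> 0"
  proof (cases "d0 = 0")
    case False
    then show ?thesis using d(1) mult_right_mono[of 1 d0 d0] by simp
  qed simp
  moreover have "0 \<le> (b - 2 * d1) * (b - 2 * d1)" by simp
  moreover have "0 \<le> (b - 1 - e0) * (b - 2 + e0)"
    using e assms(1) by (intro mult_nonneg_nonneg) auto
  moreover have "0 \<le> e1 * (b - e1)" using e by (intro mult_nonneg_nonneg) auto
  moreover have "0 \<le> e2 * (b * b - e2)"
    using e bb by (intro mult_nonneg_nonneg; linarith)
  ultimately show ?thesis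
    using bb assms(1) unfolding u v power3_eq_cube by (simp only: algebra_simps)
qed

lemma excess_split:
  assumes "b \<ge> 2"
  obtains v where "v \<in> three_digit_excess (int b)"
    "excess b x = int b ^ 3 * int (x div b ^ 3) - int (digit_square_sum b (x div b ^ 3)) + v"
proof -
  define A d0 d1 d2 where "A = x div b ^ 3" and "d0 = x mod b"
    and "d1 = x div b mod b" and "d2 = x div b div b mod b"
  have lt: "d0 < b" "d1 < b" "d2 < b"
    using assms by (auto simp: d0_def d1_def d2_def)
  have A: "A = x div b div b div b"
    by (simp add: A_def power3_eq_cube div_mult2_eq)
  have x: "x = b * (b * (b * A + d2) + d1) + d0"
    by (simp add: A d0_def d1_def d2_def)
  have "digit_square_sum b x = d0\<^sup>2 + (d1\<^sup>2 + (d2\<^sup>2 + digit_square_sum b A))"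
    unfolding x by (simp add: digit_square_sum_append_digit assms lt)
  then have "excess b x = int b ^ 3 * int A - int (digit_square_sum b A) +
     (int d2 * (int b * int b - int d2)
       + (int d0 - int d0 * int d0 + int d1 * (int b - int d1)))"
    unfolding excess_def by (subst x) (simp add: algebra_simps power2_eq_square power3_eq_cube)
  moreover have "int d2 * (int b * int b - int d2)
       + (int d0 - int d0 * int d0 + int d1 * (int b - int d1)) \<in> three_digit_excess (int b)"
    unfolding three_digit_excess_def using lt by fastforce
  ultimately show ?thesis using that unfolding A_def by blast
qed

lemma excess_block_gap:
  assumes "b \<ge> 2" "x div b ^ 3 < y div b ^ 3"
  shows "excess b x + 2 \<le> excess b y"
proof -
  define A n where "A = x div b ^ 3" and "n = y div b ^ 3 - x div b ^ 3"
  have y: "y div b ^ 3 = A + n" and n: "n \<ge> 1" using assms(2) by (auto simp: A_def n_def)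
  obtain u where u: "u \<in> three_digit_excess (int b)"
    "excess b x = int b ^ 3 * int A - int (digit_square_sum b A) + u"
    using excess_split[OF assms(1), of x] unfolding A_def by blast
  obtain v where v: "v \<in> three_digit_excess (int b)"
    "excess b y = int b ^ 3 * int (A + n) - int (digit_square_sum b (A + n)) + v"
    using excess_split[OF assms(1), of y] unfolding y by blast
  let ?g = "int b ^ 3 - 2 * int b + 3"
  \<comment> \<open>The instance \<open>v - v\<close> serves to make \<open>?g\<close> positive, so
    that \<open>n\<close> steps of \<open>A\<close> gain at least as much as one.\<close>
  have spread: "u - v + 2 \<le> ?g" and "v - v + 2 \<le> ?g"
    by (rule three_digit_excess_spread; use u(1) v(1) assms(1) in simp)+
  then have "?g * 1 \<le> ?g * int n" using n by (intro mult_left_mono) auto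
  then show ?thesis
    using spread digit_square_sum_add_le[OF assms(1), of A n] unfolding u(2) v(2)
    by (simp add: algebra_simps)
qed

lemma oasis_translate_three_digit_excess:
  assumes "b \<ge> 2" "is_oasis l b C"
  shows "\<exists>t. \<forall>j<l. t + int j \<in> three_digit_excess (int b)"
proof -
  obtain m where m: "C = {m..<m + l}" "\<forall>c\<in>C. \<exists>a. is_fixed_point c b a"
    using assms(2) by (auto simp: is_oasis_def)
  have "\<exists>x. excess b x = int (m + j)" if "j < l" for j
    using bspec[OF m(2), of "m + j"] that by (auto simp: m(1) is_fixed_point_iff)
  then obtain f where f: "\<And>j. j < l \<Longrightarrow> excess b (f j) = int (m + j)" by metis
  define A where "A = f 0 div b ^ 3"
  \<comment> \<open>Neighbouring values differ by 1, less than the gap of 2 between blocks, so the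
    block never changes.\<close>
  have same_block: "f j div b ^ 3 = A" if "j < l" for j
    using that
  proof (induction j)
    case (Suc j)
    have "\<not> f j div b ^ 3 < f (Suc j) div b ^ 3" "\<not> f (Suc j) div b ^ 3 < f j div b ^ 3"
      using excess_block_gap[OF assms(1), of "f j" "f (Suc j)"]
        excess_block_gap[OF assms(1), of "f (Suc j)" "f j"] f[of j] f[of "Suc j"] Suc.prems
      by auto
    then show ?case using Suc by auto
  qed (simp add: A_def)
  let ?T = "int b ^ 3 * int A - int (digit_square_sum b A)"
  have "int m - ?T + int j \<in> three_digit_excess (int b)" if j: "j < l" for j
  proof -
    obtain v where "v \<in> three_digit_excess (int b)" "excess b (f j) = ?T + v"
      using excess_split[OF assms(1), of "f j"] unfolding same_block[OF j] by blast
    moreover from this(2) have "v = int m - ?T + int j" using f[OF j] by simp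
    ultimately show ?thesis by simp
  qed
  then show ?thesis by blast
qed

section \<open>Enumeration of the three-digit values\<close>

fun merge :: "int list \<Rightarrow> int list \<Rightarrow> int list" where
  "merge [] ys = ys"
| "merge xs [] = xs"
| "merge (x # xs) (y # ys) =
     (if x < y then x # merge xs (y # ys)
      else if y < x then y # merge (x # xs) ys
      else x # merge xs ys)"

text \<open>Only the set of elements has to be proved; that the resulting list is increasing is
  tested later by \<open>short_runs\<close>.\<close>

lemma set_merge [simp]: "set (merge xs ys) = set xs \<union> set ys"
  by (induction xs ys rule: merge.induct) auto

text \<open>The simplifier traverses both arguments of an \<open>if\<close> again after deciding it, which is costly for
  long lists. Code equations that match on the outcomes of the comparisons avoid this.\<close>
definition merge_choice :: "bool \<Rightarrow> bool \<Rightarrow> int \<Rightarrow> int list \<Rightarrow> int \<Rightarrow> int list \<Rightarrow> int list" where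
  "merge_choice p q x xs y ys =
     (if p then x # merge xs (y # ys) else if q then y # merge (x # xs) ys else x # merge xs ys)"

lemma merge_choice_code [code]:
  "merge_choice True q x xs y ys = x # merge xs (y # ys)"
  "merge_choice False True x xs y ys = y # merge (x # xs) ys"
  "merge_choice False False x xs y ys = x # merge xs ys"
  by (simp_all add: merge_choice_def)

lemma merge_code [code]:
  "merge [] ys = ys"
  "merge (x # xs) [] = x # xs"
  "merge (x # xs) (y # ys) = merge_choice (x < y) (y < x) x xs y ys"
  by (simp_all add: merge_choice_def)

definition sumset :: "int list \<Rightarrow> int list \<Rightarrow> int list" where
  "sumset xs ys = foldr (\<lambda>x. merge (map ((+) x) ys)) xs []"

lemma sumsetI: "x \<in> set xs \<Longrightarrow> y \<in> set ys \<Longrightarrow> x + y \<in> set (sumset xs ys)"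
  unfolding sumset_def by (induction xs) auto

text \<open>The digits \<open>0\<close> and \<open>1\<close> contribute the same in the lowest position, and so do \<open>d\<close> and
  \<open>b - d\<close> in the next one.\<close>
definition three_digit_excess_list :: "int \<Rightarrow> int list" where
  "three_digit_excess_list b =
     sumset (map (\<lambda>d. d * (b * b - d)) [0..b - 1])
       (sumset (map (\<lambda>d. d - d * d) [1..b - 1]) (map (\<lambda>d. d * (b - d)) [0..b div 2]))"

lemma three_digit_excess_subset_list:
  assumes "b \<ge> 2"
  shows "three_digit_excess b \<subseteq> set (three_digit_excess_list b)"
proof
  fix v assume "v \<in> three_digit_excess b"
  then obtain d0 d1 d2 where d: "d0 \<in> {0..<b}" "d1 \<in> {0..<b}" "d2 \<in> {0..<b}"
    and v: "v = d2 * (b * b - d2) + (d0 - d0 * d0 + d1 * (b - d1))"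
    by (auto simp: three_digit_excess_def)
  have "d0 - d0 * d0 \<in> (\<lambda>d. d - d * d) ` {1..b - 1}"
    using d(1) assms by (cases "d0 = 0") (auto intro: image_eqI[of _ _ 1])
  moreover have "d1 * (b - d1) \<in> (\<lambda>d. d * (b - d)) ` {0..b div 2}"
  proof (cases "d1 \<le> b div 2")
    case False
    then have "b - d1 \<in> {0..b div 2}" using d(2) by auto
    then show ?thesis by (intro image_eqI[of _ _ "b - d1"]) auto
  qed (use d(2) in auto)
  moreover have "d2 * (b * b - d2) \<in> (\<lambda>d. d * (b * b - d)) ` {0..b - 1}"
    using d(3) by auto
  ultimately show "v \<in> set (three_digit_excess_list b)"
    unfolding v three_digit_excess_list_def by (intro sumsetI) (simp_all only: set_map set_upto)
qed

section \<open>Runs of consecutive integers in an increasing list\<close>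

text \<open>Here \<open>x\<close> is the last element read and \<open>s\<close> is the start of the run of consecutive integers that
  ends in \<open>x\<close>.\<close>
fun short_runs :: "int \<Rightarrow> int \<Rightarrow> int \<Rightarrow> int list \<Rightarrow> bool" where
  "short_runs k s x [] \<longleftrightarrow> True"
| "short_runs k s x (y # ys) \<longleftrightarrow>
     x < y \<and> (if y = x + 1 then y < s + k \<and> short_runs k s y ys else short_runs k y y ys)"

definition short_runs_choice :: "bool \<Rightarrow> bool \<Rightarrow> bool \<Rightarrow> int \<Rightarrow> int \<Rightarrow> int \<Rightarrow> int list \<Rightarrow> bool" where
  "short_runs_choice p q r k s y ys \<longleftrightarrow>
     p \<and> (if q then r \<and> short_runs k s y ys else short_runs k y y ys)"

lemma short_runs_choice_code [code]:
  "short_runs_choice False q r k s y ys \<longleftrightarrow> False"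
  "short_runs_choice True True False k s y ys \<longleftrightarrow> False"
  "short_runs_choice True True True k s y ys \<longleftrightarrow> short_runs k s y ys"
  "short_runs_choice True False r k s y ys \<longleftrightarrow> short_runs k y y ys"
  by (simp_all add: short_runs_choice_def)

lemma short_runs_code [code]:
  "short_runs k s x [] \<longleftrightarrow> True"
  "short_runs k s x (y # ys) \<longleftrightarrow>
     short_runs_choice (x < y) (y = x + 1) (y < s + k) k s y ys"
  by (simp_all add: short_runs_choice_def)

lemma short_runs_less: "short_runs k s x ys \<Longrightarrow> y \<in> set ys \<Longrightarrow> x < y"
  by (induction k s x ys rule: short_runs.induct) (auto split: if_splits)

text \<open>The interval on the left has \<open>k + 1\<close> elements, while the run
  \<open>{s..x}\<close> read so far has at most \<open>k\<close>. When a run ends,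
  \<open>x + 1\<close> is missing, so an interval inside the set lies wholly in that run or wholly
  beyond it.\<close>

lemma short_runs_not_subset:
  assumes "short_runs k s x ys" "s \<le> x" "x < s + k"
  shows "\<not> {t..t + k} \<subseteq> {s..x} \<union> set ys"
  using assms
proof (induction k s x ys rule: short_runs.induct)
  case (1 k s x)
  then show ?case using atLeastatMost_subset_iff[of t "t + k" s x] by simp
next
  case (2 k s x y ys)
  show ?case
  proof (cases "y = x + 1")
    case True
    then have "{s..x} \<union> set (y # ys) \<subseteq> {s..y} \<union> set ys" using \<open>s \<le> x\<close> by auto
    moreover have "\<not> {t..t + k} \<subseteq> {s..y} \<union> set ys" using 2 True by auto
    ultimately show ?thesis by blast
  next
    case False
    then have "short_runs k y y ys" "x + 1 < y" using 2 by auto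
    with False have IH: "\<not> {t..t + k} \<subseteq> {y..y} \<union> set ys" using 2 by simp
    have above: "x + 1 < z" if "z \<in> set (y # ys)" for z
      using short_runs_less[OF \<open>short_runs k y y ys\<close>, of z] \<open>x + 1 < y\<close> that by auto
    show ?thesis
    proof
      assume sub: "{t..t + k} \<subseteq> {s..x} \<union> set (y # ys)"
      show False
      proof (cases "t \<le> x")
        case True
        then have "s \<le> t" using sub above[of t] \<open>s \<le> x\<close> \<open>x < s + k\<close> by force
        \<comment> \<open>From \<open>t \<le> x\<close> and
          \<open>x + 1 \<le> s + k \<le> t + k\<close> the interval would contain the missing
          \<open>x + 1\<close>.\<close>
        moreover have "x + 1 \<notin> {s..x} \<union> set (y # ys)" using above[of "x + 1"] by auto
        then have "x + 1 \<notin> {t..t + k}" using sub by blast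
        ultimately show False using True \<open>x < s + k\<close> by auto
      next
        case False
        then have "{t..t + k} \<subseteq> {y..y} \<union> set ys" using sub by auto
        with IH show False by contradiction
      qed
    qed
  qed
qed

fun no_run :: "int \<Rightarrow> int list \<Rightarrow> bool" where
  "no_run k [] \<longleftrightarrow> True"
| "no_run k (x # xs) \<longleftrightarrow> short_runs k x x xs"

lemma no_runD: "no_run k xs \<Longrightarrow> 0 < k \<Longrightarrow> \<not> {t..t + k} \<subseteq> set xs"
  using short_runs_not_subset[of k "hd xs" "hd xs" "tl xs" t] by (cases xs) auto

section \<open>Finite checks that settle each base\<close>

lemma is_max_oasis_lengthI:
  assumes no_run: "no_run (int k) (three_digit_excess_list (int b))"
    and "b \<ge> 2" "k > 0"
    and witnesses: "list_all (\<lambda>x. x > 0) xs" "map (excess b) xs = map int [m..<m + k]"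
  shows "is_max_oasis_length b k"
  unfolding is_max_oasis_length_def
proof (intro conjI allI impI)
  have "\<exists>a. is_fixed_point c b a" if "c \<in> {m..<m + k}" for c
  proof -
    have "int c \<in> set (map (excess b) xs)" unfolding witnesses(2) using that by simp
    then show ?thesis
      using witnesses(1) by (auto simp: is_fixed_point_iff list_all_iff)
  qed
  then show "\<exists>C. is_oasis k b C"
    using \<open>k > 0\<close> unfolding is_oasis_def by blast
next
  fix l assume l: "k < l"
  show "\<not> (\<exists>C. is_oasis l b C)"
  proof
    assume "\<exists>C. is_oasis l b C"
    then obtain t where t: "\<forall>j<l. t + int j \<in> three_digit_excess (int b)"
      using oasis_translate_three_digit_excess[OF \<open>b \<ge> 2\<close>] by blast
    \<comment> \<open>The first \<open>k + 1\<close> elements of the longer oasis already give the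
      contradiction.\<close>
    have "{t..t + int k} \<subseteq> three_digit_excess (int b)"
    proof
      fix z assume "z \<in> {t..t + int k}"
      then have "nat (z - t) < l" "z = t + int (nat (z - t))" using l by auto
      then show "z \<in> three_digit_excess (int b)" using t by metis
    qed
    also have "\<dots> \<subseteq> set (three_digit_excess_list (int b))"
      using three_digit_excess_subset_list[of "int b"] \<open>b \<ge> 2\<close> by simp
    finally show False using no_runD[OF no_run] \<open>k > 0\<close> by simp
  qed
qed

lemma digit_square_sum_Suc_0 [simp]: "b \<ge> 2 \<Longrightarrow> digit_square_sum b (Suc 0) = 1"
  by (simp add: digit_square_sum_rec[of b "Suc 0"])

text \<open>Restricted to numerals the recursion terminates as a rewrite rule; repeated division
  ends at 0 or \<open>Suc 0\<close>.\<close>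

lemma digit_square_sum_numeral [simp]:
  "b \<ge> 2 \<Longrightarrow> digit_square_sum b (numeral w) =
     (numeral w mod b)\<^sup>2 + digit_square_sum b (numeral w div b)"
  by (rule digit_square_sum_rec)

lemma max_oasis_2: "is_max_oasis_length 2 2"
  \<comment> \<open>Here and below, entry \<open>j\<close> of \<open>xs\<close>, counted from 0, is
    a fixed point for \<open>c = m + j\<close>; the run check is done by evaluation.\<close>
  by (rule is_max_oasis_lengthI[where m = 0 and xs = "[1, 2]"], code_simp)
    (simp_all add: excess_def)

lemma max_oasis_4: "is_max_oasis_length 4 6"
  by (rule is_max_oasis_lengthI[where m = 28
        and xs = "[32, 38, 42, 36, 40, 51]"], code_simp)
    (simp_all add: excess_def)

lemma max_oasis_6: "is_max_oasis_length 6 5"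
  by (rule is_max_oasis_lengthI[where m = 5
        and xs = "[6, 14, 20, 12, 18]"], code_simp)
    (simp_all add: excess_def)

lemma max_oasis_8: "is_max_oasis_length 8 8"
  by (rule is_max_oasis_lengthI[where m = 304
        and xs = "[347, 338, 391, 336, 346, 354, 344, 352]"], code_simp)
    (simp_all add: excess_def)

lemma max_oasis_10: "is_max_oasis_length 10 8"
  by (rule is_max_oasis_lengthI[where m = 487
        and xs = "[544, 554, 522, 533, 520, 609, 543, 532]"], code_simp)
    (simp_all add: excess_def)

lemma max_oasis_12: "is_max_oasis_length 12 8"
  by (rule is_max_oasis_lengthI[where m = 172
        and xs = "[207, 194, 299, 192, 206, 218, 204, 216]"], code_simp)
    (simp_all add: excess_def)

lemma max_oasis_14: "is_max_oasis_length 14 8"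
  by (rule is_max_oasis_lengthI[where m = 421
        and xs = "[434, 451, 601, 480, 494, 450, 465, 448]"], code_simp)
    (simp_all add: excess_def)

lemma max_oasis_16: "is_max_oasis_length 16 8"
  by (rule is_max_oasis_lengthI[where m = 559
        and xs = "[628, 644, 594, 611, 592, 799, 627, 610]"], code_simp)
    (simp_all add: excess_def)

lemma max_oasis_18: "is_max_oasis_length 18 8"
  by (rule is_max_oasis_lengthI[where m = 1663
        and xs = "[1768, 1786, 1730, 1749, 1728, 1960, 1767, 1748]"], code_simp)
    (simp_all add: excess_def)

lemma max_oasis_20: "is_max_oasis_length 20 9"
  by (rule is_max_oasis_lengthI[where m = 5124
        and xs = "[5383, 5362, 5699, 5360, 5382, 5402, 5380, 5400, 5617]"], code_simp)
    (simp_all add: excess_def)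

theorem theorem11:
  shows "is_max_oasis_length 2 2
    \<and> is_max_oasis_length 4 6
    \<and> is_max_oasis_length 6 5
    \<and> (\<forall>b\<in>{8, 10, 12, 14, 16, 18}. is_max_oasis_length b 8)
    \<and> is_max_oasis_length 20 9"
  using max_oasis_2 max_oasis_4 max_oasis_6 max_oasis_8 max_oasis_10 max_oasis_12
    max_oasis_14 max_oasis_16 max_oasis_18 max_oasis_20
  by simp

end
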